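(* Let $X$ be a metric space, and suppose a group $G$ acts on $X$ properly discontinuously and co-boundedly. Let $H\le G$ be a finitely generated subgroup, and let $Y\subseteq X$ coarsely coincide with an orbit of $H$. Then $$G_Y=\bigcup\{C_G(H') \mid H'\le H,\ |H/H'|<\infty\},$$ where $G_Y$ is the coarse stabilizer of $Y$ and $C_G(H')$ denotes the centralizer of $H'$ in $G$.
   Context: All actions are by isometries. For $G$ acting on a metric space $(X,d)$ and $Y\subseteq X$, the coarse stabilizer of $Y$ is $$G_Y:=\{g\in G\mid \exists C \text{ such that } d(g\cdot y,y)\le C \text{ for all } y\in Y\}.$$ The union ranges over all finite index subgroups $H'$ of $H$. $Y$ coarsely coincides with an orbit of $H$ if $Y$ is at finite Hausdorff distance from $H\cdot x$ for some $x\in X$. The action is properly discontinuous if for every $x\in X$ and $r>0$ only finitely many $g\in G$ satisfy $d(g\cdot x,x)\le r$. It is co-bounded if some orbit is quasi-dense, i.e. there are $x_0\in X$ and $L>0$ such that every point of $X$ is within distance $L$ of $G\cdot x_0$. *)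

theory Defs
  imports "HOL-Analysis.Abstract_Metric_Spaces" "HOL-Library.Extended_Nonnegative_Real"
    "HOL-Algebra.Group_Action" "HOL-Algebra.Generated_Groups" "HOL-Algebra.Left_Coset"
begin

locale isometric_action =
  group_action G M \<phi> + Metric_space M d
  for G :: "('a, 'c) monoid_scheme" and M :: "'x set" and \<phi> :: "'a \<Rightarrow> 'x \<Rightarrow> 'x"
    and d :: "'x \<Rightarrow> 'x \<Rightarrow> real" +
  assumes isometry:
    "\<lbrakk>g \<in> carrier G; x \<in> M; y \<in> M\<rbrakk> \<Longrightarrow> d (\<phi> g x) (\<phi> g y) = d x y"

definition properly_discontinuous ::
  "('a, 'c) monoid_scheme \<Rightarrow> 'x set \<Rightarrow> ('x \<Rightarrow> 'x \<Rightarrow> real) \<Rightarrow> ('a \<Rightarrow> 'x \<Rightarrow> 'x) \<Rightarrow> bool" where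
  "properly_discontinuous G M d \<phi> \<longleftrightarrow>
     (\<forall>x\<in>M. \<forall>r>0. finite {g \<in> carrier G. d (\<phi> g x) x \<le> r})"

definition cobounded ::
  "('a, 'c) monoid_scheme \<Rightarrow> 'x set \<Rightarrow> ('x \<Rightarrow> 'x \<Rightarrow> real) \<Rightarrow> ('a \<Rightarrow> 'x \<Rightarrow> 'x) \<Rightarrow> bool" where
  "cobounded G M d \<phi> \<longleftrightarrow>
     (\<exists>x0\<in>M. \<exists>L>0. \<forall>x\<in>M. \<exists>y\<in>orbit G \<phi> x0. d x y \<le> L)"

definition coarse_stabilizer ::
  "('a, 'c) monoid_scheme \<Rightarrow> ('x \<Rightarrow> 'x \<Rightarrow> real) \<Rightarrow> ('a \<Rightarrow> 'x \<Rightarrow> 'x) \<Rightarrow> 'x set \<Rightarrow> 'a set" where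
  "coarse_stabilizer G d \<phi> Y = {g \<in> carrier G. \<exists>C. \<forall>y\<in>Y. d (\<phi> g y) y \<le> C}"

text \<open>The infimum is taken in \<^typ>\<open>ennreal\<close>, so the distance is infinite unless each
  set lies in a bounded neighbourhood of the other; in particular, the distance between the empty
  set and a nonempty set is infinite.\<close>

definition hausdorff_distance ::
  "('x \<Rightarrow> 'x \<Rightarrow> real) \<Rightarrow> 'x set \<Rightarrow> 'x set \<Rightarrow> ennreal" where
  "hausdorff_distance d A B =
     Inf {ennreal r | r. r \<ge> 0 \<and> (\<forall>a\<in>A. \<exists>b\<in>B. d a b \<le> r) \<and> (\<forall>b\<in>B. \<exists>a\<in>A. d a b \<le> r)}"

definition coarsely_coincides_with_orbit ::
  "('a, 'c) monoid_scheme \<Rightarrow> 'x set \<Rightarrow> ('x \<Rightarrow> 'x \<Rightarrow> real) \<Rightarrow> ('a \<Rightarrow> 'x \<Rightarrow> 'x) \<Rightarrow> 'a set \<Rightarrow> 'x set \<Rightarrow> bool"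
  where
  "coarsely_coincides_with_orbit G M d \<phi> H Y \<longleftrightarrow>
     (\<exists>x\<in>M. hausdorff_distance d Y (orbit (G\<lparr>carrier := H\<rparr>) \<phi> x) < \<infinity>)"

definition centralizer :: "('a, 'c) monoid_scheme \<Rightarrow> 'a set \<Rightarrow> 'a set" where
  "centralizer G S = {g \<in> carrier G. \<forall>s\<in>S. g \<otimes>\<^bsub>G\<^esub> s = s \<otimes>\<^bsub>G\<^esub> g}"

definition finitely_generated_subgroup :: "('a, 'c) monoid_scheme \<Rightarrow> 'a set \<Rightarrow> bool" where
  "finitely_generated_subgroup G H \<longleftrightarrow>
     subgroup H G \<and> (\<exists>S. finite S \<and> S \<subseteq> H \<and> H = generate G S)"

definition finite_index_subgroup :: "('a, 'c) monoid_scheme \<Rightarrow> 'a set \<Rightarrow> bool" where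
  "finite_index_subgroup G K \<longleftrightarrow> subgroup K G \<and> finite (lcosets\<^bsub>G\<^esub> K)"

end

theory Submission
  imports Defs
begin

text \<open>
  Both sides of the claimed equality describe the elements \<open>g\<close> whose orbit
  \<open>{h g h\<inverse> | h \<in> H}\<close> under conjugation by \<open>H\<close> is finite.

  The coarse stabilizer does not change when \<open>Y\<close> is replaced by a set at finite Hausdorff distance,
  since an isometry displaces two points at distance \<open>r\<close> by amounts differing by at most
  \<open>2 r\<close>; hence \<open>Y\<close> may be taken to be an orbit \<open>H x\<close>. The displacement of \<open>h\<inverse> x\<close> by \<open>g\<close> equals the
  displacement of \<open>x\<close> by the conjugate \<open>h g h\<inverse>\<close>. So \<open>g\<close> lies in the coarse stabilizer of \<open>H x\<close> iff its
  \<open>H\<close>-conjugates displace \<open>x\<close> by a bounded amount, and by proper discontinuity this happens iff there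
  are only finitely many of them (lemma \<open>coarse_stabilizer_orbit\<close>).

  On the algebraic side, \<open>H\<close>-conjugates of \<open>g\<close> correspond to left cosets in \<open>H\<close> of the subgroup of
  elements commuting with \<open>g\<close>. So there are finitely many of them iff \<open>g\<close> commutes with a finite index
  subgroup of \<open>H\<close> (lemma \<open>finite_conjugates_iff_centralizes_finite_index\<close>).
\<close>

section \<open>Finitely many conjugates and centralizers of finite index subgroups\<close>

lemma (in group) subgroup_commuting_elements:
  assumes H: "subgroup H G" and g: "g \<in> carrier G"
  shows "subgroup {k \<in> H. g \<otimes> k = k \<otimes> g} (G\<lparr>carrier := H\<rparr>)"
proof (rule subgroup_incl[OF _ H])
  show "subgroup {k \<in> H. g \<otimes> k = k \<otimes> g} G"
  proof (rule subgroupI)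
    have "\<one> \<in> {k \<in> H. g \<otimes> k = k \<otimes> g}"
      using subgroup.one_closed[OF H] g by simp
    then show "{k \<in> H. g \<otimes> k = k \<otimes> g} \<noteq> {}"
      by blast
  next
    fix a assume a: "a \<in> {k \<in> H. g \<otimes> k = k \<otimes> g}"
    then have aG: "a \<in> carrier G"
      using H by (auto dest: subgroup.mem_carrier)
    have "g \<otimes> inv a = inv a \<otimes> (a \<otimes> g) \<otimes> inv a"
      using aG g by (simp add: m_assoc[symmetric])
    also have "\<dots> = inv a \<otimes> (g \<otimes> a) \<otimes> inv a"
      using a by simp
    also have "\<dots> = inv a \<otimes> g"
      using aG g by (simp add: m_assoc)
    finally show "inv a \<in> {k \<in> H. g \<otimes> k = k \<otimes> g}"
      using a subgroup.m_inv_closed[OF H] by simp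
  next
    fix a b assume ab: "a \<in> {k \<in> H. g \<otimes> k = k \<otimes> g}" "b \<in> {k \<in> H. g \<otimes> k = k \<otimes> g}"
    then have carr: "a \<in> carrier G" "b \<in> carrier G"
      using H by (auto dest: subgroup.mem_carrier)
    have "g \<otimes> (a \<otimes> b) = (a \<otimes> g) \<otimes> b"
      using ab carr g by (simp add: m_assoc[symmetric])
    also have "\<dots> = (a \<otimes> b) \<otimes> g"
      using ab carr g by (simp add: m_assoc)
    finally show "a \<otimes> b \<in> {k \<in> H. g \<otimes> k = k \<otimes> g}"
      using ab subgroup.m_closed[OF H] by simp
  qed (use subgroup.subset[OF H] in auto)
qed auto

lemma (in group) conjugate_eq_iff_commutes:
  assumes "a \<in> carrier G" "b \<in> carrier G" "g \<in> carrier G"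
  shows "a \<otimes> g \<otimes> inv a = b \<otimes> g \<otimes> inv b \<longleftrightarrow> g \<otimes> (inv a \<otimes> b) = (inv a \<otimes> b) \<otimes> g"
proof -
  have "a \<otimes> g \<otimes> inv a = b \<otimes> g \<otimes> inv b \<longleftrightarrow>
      inv a \<otimes> (a \<otimes> g \<otimes> inv a) \<otimes> b = inv a \<otimes> (b \<otimes> g \<otimes> inv b) \<otimes> b"
    using assms by simp
  also have "inv a \<otimes> (a \<otimes> g \<otimes> inv a) \<otimes> b = g \<otimes> (inv a \<otimes> b)"
    using assms by (simp add: m_assoc inv_solve_left')
  also have "inv a \<otimes> (b \<otimes> g \<otimes> inv b) \<otimes> b = (inv a \<otimes> b) \<otimes> g"
    using assms by (simp add: m_assoc)
  finally show ?thesis .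
qed

text \<open>
  Orbit-stabilizer for the conjugation action of \<open>H\<close>: the fibres of \<open>h \<mapsto> h g h\<inverse>\<close> are the left cosets
  in \<open>H\<close> of the subgroup \<open>K\<close> of elements commuting with \<open>g\<close>. Finitely many conjugates therefore mean
  that \<open>K\<close> itself has finite index; conversely, the map is constant on the left cosets of any
  subgroup commuting with \<open>g\<close>.
\<close>

lemma (in group) finite_conjugates_iff_centralizes_finite_index:
  assumes H: "subgroup H G" and g: "g \<in> carrier G"
  shows "finite ((\<lambda>h. h \<otimes> g \<otimes> inv h) ` H) \<longleftrightarrow>
    (\<exists>K. finite_index_subgroup (G\<lparr>carrier := H\<rparr>) K \<and> g \<in> centralizer G K)"
proof
  assume fin: "finite ((\<lambda>h. h \<otimes> g \<otimes> inv h) ` H)"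
  define K where "K = {k \<in> H. g \<otimes> k = k \<otimes> g}"
  have coset_eq_fibre: "a <#\<^bsub>G\<lparr>carrier := H\<rparr>\<^esub> K = {h \<in> H. a \<otimes> g \<otimes> inv a = h \<otimes> g \<otimes> inv h}"
    if a: "a \<in> H" for a
  proof (intro equalityI subsetI)
    fix h assume "h \<in> a <#\<^bsub>G\<lparr>carrier := H\<rparr>\<^esub> K"
    then obtain k where k: "k \<in> H" "g \<otimes> k = k \<otimes> g" "h = a \<otimes> k"
      by (auto simp: l_coset_def K_def)
    have "inv a \<otimes> h = k"
      using k a subgroup.mem_carrier[OF H] by (simp add: m_assoc[symmetric])
    then show "h \<in> {h \<in> H. a \<otimes> g \<otimes> inv a = h \<otimes> g \<otimes> inv h}"
      using k a g subgroup.mem_carrier[OF H] subgroup.m_closed[OF H]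
        conjugate_eq_iff_commutes[of a h g] by auto
  next
    fix h assume h: "h \<in> {h \<in> H. a \<otimes> g \<otimes> inv a = h \<otimes> g \<otimes> inv h}"
    then have "inv a \<otimes> h \<in> K"
      using a g subgroup.mem_carrier[OF H] subgroup.m_closed[OF H] subgroup.m_inv_closed[OF H]
        conjugate_eq_iff_commutes[of a h g] unfolding K_def by auto
    moreover have "h = a \<otimes> (inv a \<otimes> h)"
      using a h subgroup.mem_carrier[OF H] by (simp add: m_assoc[symmetric])
    ultimately show "h \<in> a <#\<^bsub>G\<lparr>carrier := H\<rparr>\<^esub> K"
      by (auto simp: l_coset_def)
  qed
  have "lcosets\<^bsub>G\<lparr>carrier := H\<rparr>\<^esub> K \<subseteq>
      (\<lambda>c. {h \<in> H. c = h \<otimes> g \<otimes> inv h}) ` (\<lambda>h. h \<otimes> g \<otimes> inv h) ` H"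
    using coset_eq_fibre by (auto simp: LCOSETS_def)
  then have "finite (lcosets\<^bsub>G\<lparr>carrier := H\<rparr>\<^esub> K)"
    using fin finite_subset by blast
  moreover have "subgroup K (G\<lparr>carrier := H\<rparr>)"
    unfolding K_def by (rule subgroup_commuting_elements[OF H g])
  moreover have "g \<in> centralizer G K"
    using g by (auto simp: centralizer_def K_def)
  ultimately show "\<exists>K. finite_index_subgroup (G\<lparr>carrier := H\<rparr>) K \<and> g \<in> centralizer G K"
    by (auto simp: finite_index_subgroup_def)
next
  assume "\<exists>K. finite_index_subgroup (G\<lparr>carrier := H\<rparr>) K \<and> g \<in> centralizer G K"
  then obtain K where K: "subgroup K (G\<lparr>carrier := H\<rparr>)" "finite (lcosets\<^bsub>G\<lparr>carrier := H\<rparr>\<^esub> K)"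
    and comm: "\<And>k. k \<in> K \<Longrightarrow> g \<otimes> k = k \<otimes> g"
    by (auto simp: finite_index_subgroup_def centralizer_def)
  have KH: "K \<subseteq> H"
    using subgroup.subset[OF K(1)] by simp
  have "\<one> \<in> K"
    using subgroup.one_closed[OF K(1)] by simp
  have conj_on_coset: "b \<otimes> g \<otimes> inv b = a \<otimes> g \<otimes> inv a"
    if a: "a \<in> H" and b: "b \<in> a <#\<^bsub>G\<lparr>carrier := H\<rparr>\<^esub> K" for a b
  proof -
    obtain k where k: "k \<in> K" "b = a \<otimes> k"
      using b by (auto simp: l_coset_def)
    have carr: "a \<in> carrier G" "k \<in> carrier G"
      using a k KH subgroup.mem_carrier[OF H] by auto
    then have "inv a \<otimes> b = k"
      using k by (simp add: m_assoc[symmetric])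
    then show ?thesis
      using comm[OF k(1)] conjugate_eq_iff_commutes[of a b g] carr k g by simp
  qed
  have "(\<lambda>h. h \<otimes> g \<otimes> inv h) ` H \<subseteq>
      (\<lambda>C. (SOME b. b \<in> C) \<otimes> g \<otimes> inv (SOME b. b \<in> C)) ` (lcosets\<^bsub>G\<lparr>carrier := H\<rparr>\<^esub> K)"
  proof (rule image_subsetI)
    fix a assume a: "a \<in> H"
    let ?C = "a <#\<^bsub>G\<lparr>carrier := H\<rparr>\<^esub> K"
    have "a \<otimes> \<one> \<in> ?C"
      using \<open>\<one> \<in> K\<close> unfolding l_coset_def by auto
    then have "(SOME b. b \<in> ?C) \<in> ?C"
      by (rule someI)
    then have "a \<otimes> g \<otimes> inv a = (SOME b. b \<in> ?C) \<otimes> g \<otimes> inv (SOME b. b \<in> ?C)"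
      using conj_on_coset[OF a] by simp
    moreover have "?C \<in> lcosets\<^bsub>G\<lparr>carrier := H\<rparr>\<^esub> K"
      using a by (auto simp: LCOSETS_def)
    ultimately show "a \<otimes> g \<otimes> inv a \<in>
        (\<lambda>C. (SOME b. b \<in> C) \<otimes> g \<otimes> inv (SOME b. b \<in> C)) ` (lcosets\<^bsub>G\<lparr>carrier := H\<rparr>\<^esub> K)"
      by (rule image_eqI)
  qed
  then show "finite ((\<lambda>h. h \<otimes> g \<otimes> inv h) ` H)"
    using K(2) finite_subset by blast
qed

section \<open>Coarse stabilizers and conjugation\<close>

lemma hausdorff_distance_finiteE:
  assumes "hausdorff_distance d A B < \<infinity>"
  obtains r where "\<And>a. a \<in> A \<Longrightarrow> \<exists>b\<in>B. d a b \<le> r" "\<And>b. b \<in> B \<Longrightarrow> \<exists>a\<in>A. d a b \<le> r"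
  using assms unfolding hausdorff_distance_def by (auto simp: Inf_less_iff)

context isometric_action
begin

text \<open>
  If \<open>y\<close> and \<open>z\<close> are \<open>r\<close>-close then so are their images under \<open>g\<close>, so a bound on displacements
  passes from \<open>Z\<close> to \<open>Y\<close>. Used in both directions, this makes the coarse stabilizer invariant under
  perturbations of finite Hausdorff distance.
\<close>

lemma coarse_stabilizer_mono_coarse:
  assumes "Y \<subseteq> M" "Z \<subseteq> M" and near: "\<And>y. y \<in> Y \<Longrightarrow> \<exists>z\<in>Z. d y z \<le> r"
  shows "coarse_stabilizer G d \<phi> Z \<subseteq> coarse_stabilizer G d \<phi> Y"
proof
  fix g assume "g \<in> coarse_stabilizer G d \<phi> Z"
  then obtain C where g: "g \<in> carrier G" and C: "\<And>z. z \<in> Z \<Longrightarrow> d (\<phi> g z) z \<le> C"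
    by (auto simp: coarse_stabilizer_def)
  have "d (\<phi> g y) y \<le> 2 * r + C" if y: "y \<in> Y" for y
  proof -
    obtain z where z: "z \<in> Z" "d y z \<le> r"
      using near[OF y] by blast
    have carr: "y \<in> M" "z \<in> M" "\<phi> g y \<in> M" "\<phi> g z \<in> M"
      using assms y z element_image[OF g] by auto
    have "d (\<phi> g y) y \<le> d (\<phi> g y) (\<phi> g z) + (d (\<phi> g z) z + d z y)"
      using triangle[of "\<phi> g y" "\<phi> g z" y] triangle[of "\<phi> g z" z y] carr by linarith
    also have "d (\<phi> g y) (\<phi> g z) = d y z"
      using isometry[OF g] carr by simp
    also have "d z y = d y z"
      by (rule commute)
    finally show ?thesis
      using C[OF z(1)] z(2) by linarith
  qed
  then show "g \<in> coarse_stabilizer G d \<phi> Y"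
    using g by (auto simp: coarse_stabilizer_def)
qed

lemma displacement_conjugate:
  assumes "g \<in> carrier G" "h \<in> carrier G" "x \<in> M"
  shows "d (\<phi> (h \<otimes>\<^bsub>G\<^esub> g \<otimes>\<^bsub>G\<^esub> inv\<^bsub>G\<^esub> h) x) x = d (\<phi> g (\<phi> (inv\<^bsub>G\<^esub> h) x)) (\<phi> (inv\<^bsub>G\<^esub> h) x)"
proof -
  interpret group G
    using group_hom group_hom.axioms(1) by auto
  have inv_h: "inv\<^bsub>G\<^esub> h \<in> carrier G"
    using assms by simp
  have carr: "\<phi> (inv\<^bsub>G\<^esub> h) x \<in> M" "\<phi> g (\<phi> (inv\<^bsub>G\<^esub> h) x) \<in> M"
    using assms inv_h element_image by blast+
  have "\<phi> h (\<phi> (inv\<^bsub>G\<^esub> h) x) = x"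
    using orbit_sym_aux[OF inv_h assms(3) refl] assms by simp
  moreover have "\<phi> (h \<otimes>\<^bsub>G\<^esub> g \<otimes>\<^bsub>G\<^esub> inv\<^bsub>G\<^esub> h) x = \<phi> h (\<phi> g (\<phi> (inv\<^bsub>G\<^esub> h) x))"
    using assms inv_h carr by (simp add: composition_rule)
  ultimately show ?thesis
    using isometry[OF assms(2) carr(2,1)] by simp
qed

lemma orbit_subgroup_subset:
  assumes "subgroup H G" "x \<in> M"
  shows "orbit (G\<lparr>carrier := H\<rparr>) \<phi> x \<subseteq> M"
  using assms element_image subgroup.mem_carrier by (fastforce simp: orbit_def)

text \<open>
  The displacements by \<open>g\<close> of the points of \<open>H x\<close> are those of the single point \<open>x\<close> by the conjugates
  of \<open>g\<close> under \<open>H\<close>. Proper discontinuity turns a bound on the latter into finiteness of the set of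
  conjugates.
\<close>

lemma coarse_stabilizer_orbit:
  assumes pd: "properly_discontinuous G M d \<phi>" and H: "subgroup H G" and x: "x \<in> M"
  shows "coarse_stabilizer G d \<phi> (orbit (G\<lparr>carrier := H\<rparr>) \<phi> x) =
    {g \<in> carrier G. finite ((\<lambda>h. h \<otimes>\<^bsub>G\<^esub> g \<otimes>\<^bsub>G\<^esub> inv\<^bsub>G\<^esub> h) ` H)}"
proof (intro equalityI subsetI)
  interpret group G
    using group_hom group_hom.axioms(1) by auto
  fix g assume "g \<in> coarse_stabilizer G d \<phi> (orbit (G\<lparr>carrier := H\<rparr>) \<phi> x)"
  then obtain C where g: "g \<in> carrier G"
    and C: "\<And>h. h \<in> H \<Longrightarrow> d (\<phi> g (\<phi> h x)) (\<phi> h x) \<le> C"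
    by (auto simp: coarse_stabilizer_def orbit_def)
  have "(\<lambda>h. h \<otimes>\<^bsub>G\<^esub> g \<otimes>\<^bsub>G\<^esub> inv\<^bsub>G\<^esub> h) ` H \<subseteq> {c \<in> carrier G. d (\<phi> c x) x \<le> max C 1}"
  proof (rule image_subsetI)
    fix h assume h: "h \<in> H"
    then have "h \<in> carrier G"
      using subgroup.mem_carrier[OF H] by simp
    moreover have "d (\<phi> (h \<otimes>\<^bsub>G\<^esub> g \<otimes>\<^bsub>G\<^esub> inv\<^bsub>G\<^esub> h) x) x \<le> C"
      using displacement_conjugate[OF g \<open>h \<in> carrier G\<close> x] C subgroup.m_inv_closed[OF H h] by simp
    ultimately show "h \<otimes>\<^bsub>G\<^esub> g \<otimes>\<^bsub>G\<^esub> inv\<^bsub>G\<^esub> h \<in> {c \<in> carrier G. d (\<phi> c x) x \<le> max C 1}"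
      using g by auto
  qed
  moreover have "finite {c \<in> carrier G. d (\<phi> c x) x \<le> max C 1}"
    using pd x unfolding properly_discontinuous_def by (meson less_max_iff_disj zero_less_one)
  ultimately show "g \<in> {g \<in> carrier G. finite ((\<lambda>h. h \<otimes>\<^bsub>G\<^esub> g \<otimes>\<^bsub>G\<^esub> inv\<^bsub>G\<^esub> h) ` H)}"
    using g finite_subset by blast
next
  interpret group G
    using group_hom group_hom.axioms(1) by auto
  fix g assume "g \<in> {g \<in> carrier G. finite ((\<lambda>h. h \<otimes>\<^bsub>G\<^esub> g \<otimes>\<^bsub>G\<^esub> inv\<^bsub>G\<^esub> h) ` H)}"
  then have g: "g \<in> carrier G" and fin: "finite ((\<lambda>c. d (\<phi> c x) x) ` (\<lambda>h. h \<otimes>\<^bsub>G\<^esub> g \<otimes>\<^bsub>G\<^esub> inv\<^bsub>G\<^esub> h) ` H)"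
    by auto
  let ?C = "Max ((\<lambda>c. d (\<phi> c x) x) ` (\<lambda>h. h \<otimes>\<^bsub>G\<^esub> g \<otimes>\<^bsub>G\<^esub> inv\<^bsub>G\<^esub> h) ` H)"
  have "d (\<phi> g (\<phi> h x)) (\<phi> h x) \<le> ?C" if h: "h \<in> H" for h
  proof -
    have hG: "h \<in> carrier G" and inv_h: "inv\<^bsub>G\<^esub> h \<in> H"
      using h subgroup.mem_carrier[OF H] subgroup.m_inv_closed[OF H] by auto
    have "d (\<phi> g (\<phi> h x)) (\<phi> h x) = d (\<phi> (inv\<^bsub>G\<^esub> h \<otimes>\<^bsub>G\<^esub> g \<otimes>\<^bsub>G\<^esub> inv\<^bsub>G\<^esub> (inv\<^bsub>G\<^esub> h)) x) x"
      using displacement_conjugate[OF g inv_closed[OF hG] x] hG by simp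
    also have "\<dots> \<le> ?C"
      using fin inv_h by (intro Max_ge) blast+
    finally show ?thesis .
  qed
  then show "g \<in> coarse_stabilizer G d \<phi> (orbit (G\<lparr>carrier := H\<rparr>) \<phi> x)"
    using g by (auto simp: coarse_stabilizer_def orbit_def)
qed

end

theorem theorem1p11:
  fixes G :: "('a, 'c) monoid_scheme" and M :: "'x set" and d :: "'x \<Rightarrow> 'x \<Rightarrow> real"
    and \<phi> :: "'a \<Rightarrow> 'x \<Rightarrow> 'x" and H :: "'a set" and Y :: "'x set"
  assumes "isometric_action G M \<phi> d"
    and "properly_discontinuous G M d \<phi>"
    and "cobounded G M d \<phi>"
    and "finitely_generated_subgroup G H"
    and "Y \<subseteq> M"
    and "coarsely_coincides_with_orbit G M d \<phi> H Y"
  shows "coarse_stabilizer G d \<phi> Y =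
    \<Union>{centralizer G H' | H'. finite_index_subgroup (G\<lparr>carrier := H\<rparr>) H'}"
proof -
  interpret isometric_action G M \<phi> d
    by (fact assms(1))
  interpret group G
    using group_hom group_hom.axioms(1) by auto
  have H: "subgroup H G"
    using assms(4) by (simp add: finitely_generated_subgroup_def)
  obtain x where x: "x \<in> M" and "hausdorff_distance d Y (orbit (G\<lparr>carrier := H\<rparr>) \<phi> x) < \<infinity>"
    using assms(6) by (auto simp: coarsely_coincides_with_orbit_def)
  then obtain r where
    r: "\<And>y. y \<in> Y \<Longrightarrow> \<exists>z\<in>orbit (G\<lparr>carrier := H\<rparr>) \<phi> x. d y z \<le> r"
      "\<And>z. z \<in> orbit (G\<lparr>carrier := H\<rparr>) \<phi> x \<Longrightarrow> \<exists>y\<in>Y. d y z \<le> r"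
    using hausdorff_distance_finiteE by metis
  have orbit_subset: "orbit (G\<lparr>carrier := H\<rparr>) \<phi> x \<subseteq> M"
    by (rule orbit_subgroup_subset[OF H x])
  have "coarse_stabilizer G d \<phi> Y = coarse_stabilizer G d \<phi> (orbit (G\<lparr>carrier := H\<rparr>) \<phi> x)"
  proof (rule equalityI)
    show "coarse_stabilizer G d \<phi> Y \<subseteq> coarse_stabilizer G d \<phi> (orbit (G\<lparr>carrier := H\<rparr>) \<phi> x)"
      using orbit_subset assms(5) r(2) by (intro coarse_stabilizer_mono_coarse) (auto simp: commute)
    show "coarse_stabilizer G d \<phi> (orbit (G\<lparr>carrier := H\<rparr>) \<phi> x) \<subseteq> coarse_stabilizer G d \<phi> Y"
      using orbit_subset assms(5) r(1) by (intro coarse_stabilizer_mono_coarse)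
  qed
  also have "\<dots> = {g \<in> carrier G. finite ((\<lambda>h. h \<otimes>\<^bsub>G\<^esub> g \<otimes>\<^bsub>G\<^esub> inv\<^bsub>G\<^esub> h) ` H)}"
    by (rule coarse_stabilizer_orbit[OF assms(2) H x])
  also have "\<dots> = \<Union>{centralizer G H' | H'. finite_index_subgroup (G\<lparr>carrier := H\<rparr>) H'}"
  proof (rule Set.set_eqI)
    fix g
    have "g \<in> carrier G" if "g \<in> centralizer G K" for K
      using that by (simp add: centralizer_def)
    then have "g \<in> {g \<in> carrier G. finite ((\<lambda>h. h \<otimes>\<^bsub>G\<^esub> g \<otimes>\<^bsub>G\<^esub> inv\<^bsub>G\<^esub> h) ` H)} \<longleftrightarrow>
        (\<exists>K. finite_index_subgroup (G\<lparr>carrier := H\<rparr>) K \<and> g \<in> centralizer G K)"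
      using finite_conjugates_iff_centralizes_finite_index[OF H, of g] by (metis (lifting) mem_Collect_eq)
    also have "\<dots> \<longleftrightarrow> g \<in> \<Union>{centralizer G H' | H'. finite_index_subgroup (G\<lparr>carrier := H\<rparr>) H'}"
      unfolding Union_iff by blast
    finally show "g \<in> {g \<in> carrier G. finite ((\<lambda>h. h \<otimes>\<^bsub>G\<^esub> g \<otimes>\<^bsub>G\<^esub> inv\<^bsub>G\<^esub> h) ` H)} \<longleftrightarrow>
        g \<in> \<Union>{centralizer G H' | H'. finite_index_subgroup (G\<lparr>carrier := H\<rparr>) H'}" .
  qed
  finally show ?thesis .
qed

end
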